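(* Let $r$ be a positive integer. Let $\mathcal{P}$ be the set of Dyck paths having no ascending run and no descending run of length in $\{1, \dots, r\}$. Then $\mathcal{P}$ satisfies the grammatical equation $$\mathcal{P} \cup UD\mathcal{P} = \{\epsilon\} \cup U^{r+1}D^{r+1}\mathcal{P} \cup U\mathcal{P}D\mathcal{P},$$ where $\epsilon$ is the empty path, and therefore $$P(z) + zP(z) = 1 + z^{r+1}P(z) + zP(z)^2,$$ where $P(z)$ is the weight-enumerator of $\mathcal{P}$.
   Context: A Dyck path is a finite (possibly empty) word in the letters $U$ (standing for $+1$) and $D$ (standing for $-1$) whose partial sums are all nonnegative and whose total sum is $0$. A Dyck path of length $2n$ is said to have semilength $n$. An ascending run (up-run) of length $\ell$ is a block of $\ell$ consecutive $U$'s that is neither preceded nor followed by a $U$; a descending run (down-run) of length $\ell$ is a block of $\ell$ consecutive $D$'s that is neither preceded nor followed by a $D$. A grammatical equation is an equality of sets of words over $\{U,D\}$, combined by concatenation: for languages $L, L'$, $LL'$ is the set of words $ww'$ with $w\in L$, $w'\in L'$; $L^k$ is the $k$-fold concatenation, $L^0=\{\epsilon\}$; $U$ and $D$ denote the one-letter languages. The weight-enumerator of $\mathcal{P}$ is the formal power series $P(z) = \sum_{n \geq 0} p_n z^n$, where $p_n$ is the number of paths of semilength $n$ in $\mathcal{P}$. *)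

theory Defs
  imports Main "HOL-Computational_Algebra.Formal_Power_Series"
begin

datatype step = U | D

fun step_val :: "step \<Rightarrow> int" where
  "step_val U = 1"
| "step_val D = -1"

definition height :: "step list \<Rightarrow> int" where
  "height w = sum_list (map step_val w)"

definition dyck_path :: "step list \<Rightarrow> bool" where
  "dyck_path w \<longleftrightarrow> (\<forall>k\<le>length w. height (take k w) \<ge> 0) \<and> height w = 0"

text \<open>A maximal block of \<open>l\<close> equal letters \<open>c\<close>: an ascending run for \<open>c = U\<close>,
  a descending run for \<open>c = D\<close>.\<close>

definition has_run :: "step \<Rightarrow> nat \<Rightarrow> step list \<Rightarrow> bool" where
  "has_run c l w \<longleftrightarrow> l > 0 \<and>
     (\<exists>xs ys. w = xs @ replicate l c @ ys \<and> (xs = [] \<or> last xs \<noteq> c) \<and> (ys = [] \<or> hd ys \<noteq> c))"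

definition long_run_paths :: "nat \<Rightarrow> step list set" where
  "long_run_paths r =
     {w. dyck_path w \<and> (\<forall>l\<in>{1..r}. \<not> has_run U l w \<and> \<not> has_run D l w)}"

definition conc :: "'a list set \<Rightarrow> 'a list set \<Rightarrow> 'a list set" (infixr "@@" 75) where
  "A @@ B = {xs @ ys | xs ys. xs \<in> A \<and> ys \<in> B}"

primrec lang_pow :: "'a list set \<Rightarrow> nat \<Rightarrow> 'a list set" where
  "lang_pow A 0 = {[]}"
| "lang_pow A (Suc k) = A @@ lang_pow A k"

text \<open>A path of semilength \<open>n\<close> has length \<open>2 * n\<close>. The cardinality is always that of a finite set,
  since there are finitely many words of each length.\<close>

definition weight_enumerator :: "step list set \<Rightarrow> int fps" where
  "weight_enumerator L = Abs_fps (\<lambda>n. int (card {w \<in> L. length w = 2 * n}))"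

end

theory Submission
  imports Defs
begin

text \<open>Every nonempty Dyck path factors uniquely at its first return as \<open>U w D w'\<close> with Dyck
  paths \<open>w\<close> and \<open>w'\<close>. Its runs are those of \<open>U w D\<close> together with those of \<open>w'\<close>. Passing from
  \<open>w\<close> to \<open>U w D\<close> only lengthens the initial ascending and the final descending run by one, so
  \<open>U w D\<close> can have all runs longer than \<open>r\<close> while \<open>w\<close> does not only if one of these two runs
  of \<open>w\<close> has length exactly \<open>r\<close>. Being adjacent to a run which would have to be longer than \<open>r\<close>
  and would thus leave the upper half-plane, such a run forces \<open>w = U\<^sup>rD\<^sup>r\<close>.\<close>

section \<open>Runs\<close>

text \<open>Separates the two letters: cutting a word can only disturb runs of the letter that
  stands on both sides of the cut.\<close>

definition long_runs :: "nat \<Rightarrow> step \<Rightarrow> step list \<Rightarrow> bool" where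
  "long_runs r c w \<longleftrightarrow> (\<forall>l\<in>{1..r}. \<not> has_run c l w)"

text \<open>The second hypothesis says that the cut does not lie between two letters
  \<open>c\<close>, so a run that is maximal in \<open>v\<close> remains maximal in
  \<open>v @ w\<close>.\<close>

lemma has_run_appendI1:
  assumes "has_run c l v" "\<not> (v \<noteq> [] \<and> w \<noteq> [] \<and> last v = c \<and> hd w = c)"
  shows "has_run c l (v @ w)"
proof -
  from assms(1) obtain xs ys where *: "l > 0" "v = xs @ replicate l c @ ys"
    "xs = [] \<or> last xs \<noteq> c" "ys = [] \<or> hd ys \<noteq> c"
    unfolding has_run_def by blast
  have "ys @ w = [] \<or> hd (ys @ w) \<noteq> c"
    using * assms(2) by (cases "ys = []") (auto simp: last_append)
  moreover have "v @ w = xs @ replicate l c @ (ys @ w)"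
    using * by simp
  ultimately show ?thesis
    unfolding has_run_def using * by blast
qed

lemma has_run_appendI2:
  assumes "has_run c l w" "\<not> (v \<noteq> [] \<and> w \<noteq> [] \<and> last v = c \<and> hd w = c)"
  shows "has_run c l (v @ w)"
proof -
  from assms(1) obtain xs ys where *: "l > 0" "w = xs @ replicate l c @ ys"
    "xs = [] \<or> last xs \<noteq> c" "ys = [] \<or> hd ys \<noteq> c"
    unfolding has_run_def by blast
  have "v @ xs = [] \<or> last (v @ xs) \<noteq> c"
    using * assms(2) by (cases "xs = []") (auto simp: hd_append)
  moreover have "v @ w = (v @ xs) @ replicate l c @ ys"
    using * by simp
  ultimately show ?thesis
    unfolding has_run_def using * by blast
qed

lemma has_run_appendD:
  assumes "has_run c l (v @ w)" "\<not> (v \<noteq> [] \<and> w \<noteq> [] \<and> last v = c \<and> hd w = c)"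
  shows "has_run c l v \<or> has_run c l w"
proof -
  from assms(1) obtain xs ys where *: "l > 0" "v @ w = xs @ replicate l c @ ys"
    "xs = [] \<or> last xs \<noteq> c" "ys = [] \<or> hd ys \<noteq> c"
    unfolding has_run_def by blast
  from *(2) consider (right) us where "xs = v @ us" "w = us @ replicate l c @ ys"
    | (left) us where "v = xs @ us" "us @ w = replicate l c @ ys"
    by (auto simp: append_eq_append_conv2)
  then show ?thesis
  proof cases
    case right
    then have "us = [] \<or> last us \<noteq> c"
      using *(3) by (auto simp: last_append split: if_splits)
    then show ?thesis
      unfolding has_run_def using right * by blast
  next
    case left
    from left(2) consider (inside) vs where "us = replicate l c @ vs" "ys = vs @ w"
      | (across) vs where "replicate l c = us @ vs" "w = vs @ ys"
      unfolding append_eq_append_conv2 by metis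
    then show ?thesis
    proof cases
      case inside
      then have "vs = [] \<or> hd vs \<noteq> c"
        using *(4) by (auto simp: hd_append split: if_splits)
      then show ?thesis
        unfolding has_run_def using left inside * by blast
    next
      \<comment> \<open>The block straddles the cut, with \<open>us\<close> ending \<open>v\<close>
        and \<open>vs\<close> starting \<open>w\<close>. Unless one of them is empty,
        \<open>c\<close> stands on both sides of the cut.\<close>
      case across
      have sub: "set us \<subseteq> {c}" "set vs \<subseteq> {c}"
        using arg_cong[OF across(1), of set] by (auto split: if_splits)
      consider "us = []" | "vs = []" | "us \<noteq> []" "vs \<noteq> []" by blast
      then show ?thesis
      proof cases
        case 1
        then have "w = [] @ replicate l c @ ys" using across by simp
        then show ?thesis unfolding has_run_def using * by blast
      next
        case 2
        then have "v = xs @ replicate l c @ []" using across left by simp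
        then show ?thesis unfolding has_run_def using * by blast
      next
        case 3
        have "last us = c" "hd vs = c"
          using sub last_in_set[OF 3(1)] hd_in_set[OF 3(2)] by blast+
        then show ?thesis using assms(2) 3 left across by auto
      qed
    qed
  qed
qed

text \<open>The working tool for all run computations below: words are cut only where
  \<open>c\<close> does not stand on both sides.\<close>

lemma long_runs_append:
  assumes "\<not> (v \<noteq> [] \<and> w \<noteq> [] \<and> last v = c \<and> hd w = c)"
  shows "long_runs r c (v @ w) \<longleftrightarrow> long_runs r c v \<and> long_runs r c w"
  unfolding long_runs_def
  using has_run_appendI1[OF _ assms] has_run_appendI2[OF _ assms] has_run_appendD[OF _ assms]
  by blast

lemma has_run_replicate: "has_run c l (replicate a d) \<longleftrightarrow> d = c \<and> l = a \<and> 0 < l"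
proof
  assume "has_run c l (replicate a d)"
  then obtain xs ys where *: "l > 0" "replicate a d = xs @ replicate l c @ ys"
    "xs = [] \<or> last xs \<noteq> c" "ys = [] \<or> hd ys \<noteq> c"
    unfolding has_run_def by blast
  have "set xs \<union> {c} \<union> set ys \<subseteq> {d}"
    using *(1) arg_cong[OF *(2), of set]
    by (auto simp: set_replicate_conv_if split: if_splits)
  then have "d = c" and sub: "set xs \<subseteq> {c}" "set ys \<subseteq> {c}" by auto
  moreover have "xs = []" using *(3) sub last_in_set[of xs] by blast
  moreover have "ys = []" using *(4) sub hd_in_set[of ys] by blast
  ultimately show "d = c \<and> l = a \<and> 0 < l"
    using * arg_cong[OF *(2), of length] by simp
next
  assume *: "d = c \<and> l = a \<and> 0 < l"
  then have "replicate a d = [] @ replicate l c @ []" by simp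
  then show "has_run c l (replicate a d)" unfolding has_run_def using * by blast
qed

lemma long_runs_replicate: "long_runs r c (replicate a d) \<longleftrightarrow> d \<noteq> c \<or> a = 0 \<or> r < a"
  unfolding long_runs_def has_run_replicate by auto

lemma long_runs_Nil: "long_runs r c []"
  using long_runs_replicate[of r c 0 c] by simp

lemma initial_run:
  obtains a v where "w = replicate a c @ v" "v = [] \<or> hd v \<noteq> c"
proof -
  have "\<exists>a v. w = replicate a c @ v \<and> (v = [] \<or> hd v \<noteq> c)"
  proof (induction w)
    case (Cons x w)
    then obtain a v where "w = replicate a c @ v" "v = [] \<or> hd v \<noteq> c" by blast
    then have "x = c \<Longrightarrow> x # w = replicate (Suc a) c @ v" by simp
    moreover have "x # w = replicate 0 c @ (x # w)" by simp
    ultimately show ?case using \<open>v = [] \<or> hd v \<noteq> c\<close> by (metis list.sel(1))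
  qed simp
  then show ?thesis using that by blast
qed

lemma final_run:
  obtains a v where "w = v @ replicate a c" "v = [] \<or> last v \<noteq> c"
proof -
  obtain a v where *: "rev w = replicate a c @ v" "v = [] \<or> hd v \<noteq> c"
    by (rule initial_run)
  have "w = rev v @ replicate a c"
    using arg_cong[OF *(1), of rev] by simp
  with *(2) that show ?thesis by (auto simp: last_rev)
qed

section \<open>First-return decomposition\<close>

lemma step_neq: "c \<noteq> U \<longleftrightarrow> c = D" "c \<noteq> D \<longleftrightarrow> c = U"
  by (cases c; simp)+

lemma height_simps [simp]:
  "height [] = 0"
  "height (x # w) = step_val x + height w"
  "height (v @ w) = height v + height w"
  "height (replicate n x) = int n * step_val x"
  by (simp_all add: height_def sum_list_replicate)

text \<open>Factorizations replace \<open>take\<close>, so that prefixes can be handled by the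
  algebra of \<open>@\<close>.\<close>

lemma dyck_path_iff:
  "dyck_path w \<longleftrightarrow> (\<forall>xs ys. w = xs @ ys \<longrightarrow> 0 \<le> height xs) \<and> height w = 0"
proof -
  have "(\<forall>k\<le>length w. 0 \<le> height (take k w)) \<longleftrightarrow> (\<forall>xs ys. w = xs @ ys \<longrightarrow> 0 \<le> height xs)"
    by (metis append_eq_conv_conj append_take_drop_id le_add1 length_append)
  then show ?thesis unfolding dyck_path_def by simp
qed

lemma dyck_path_prefix: "dyck_path (xs @ ys) \<Longrightarrow> 0 \<le> height xs"
  unfolding dyck_path_iff by blast

lemma dyck_path_height: "dyck_path w \<Longrightarrow> height w = 0"
  unfolding dyck_path_def by blast

lemma dyck_path_Nil [simp]: "dyck_path []"
  by (simp add: dyck_path_def)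

text \<open>Both letters have odd value, so height and length agree modulo 2.\<close>

lemma even_length_dyck_path:
  assumes "dyck_path w"
  shows "even (length w)"
proof -
  have "even (height w - int (length w))" for w
  proof (induction w)
    case (Cons x w)
    then show ?case by (cases x) simp_all
  qed simp
  from this[of w] show ?thesis using dyck_path_height[OF assms] by simp
qed

lemma dyck_path_hd:
  assumes "dyck_path w" "w \<noteq> []"
  shows "hd w = U"
proof (rule ccontr)
  assume "hd w \<noteq> U"
  with assms(2) have "w = [D] @ tl w"
    by (cases w) (auto simp: step_neq)
  with assms(1) have "0 \<le> height [D]" using dyck_path_prefix by metis
  then show False by simp
qed

lemma dyck_path_last:
  assumes "dyck_path w" "w \<noteq> []"
  shows "last w = D"
proof (rule ccontr)
  assume "last w \<noteq> D"
  with assms(2) have w: "w = butlast w @ [U]"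
    by (metis append_butlast_last_id step_neq(2))
  with assms(1) have "0 \<le> height (butlast w)" using dyck_path_prefix by metis
  moreover have "height (butlast w) + 1 = 0"
    using dyck_path_height[OF assms(1)] w
    by (metis height_simps(1-3) step_val.simps(1) add.right_neutral)
  ultimately show False by simp
qed

lemma dyck_path_first_returnI:
  assumes "dyck_path v" "dyck_path w"
  shows "dyck_path (U # v @ D # w)"
proof -
  have "0 \<le> height xs" if "U # v @ D # w = xs @ ys" for xs ys
  proof (cases xs)
    case (Cons x xs')
    with that have x: "x = U" and *: "v @ D # w = xs' @ ys" by auto
    from * consider us where "v = xs' @ us" | us where "xs' = v @ us" "D # w = us @ ys"
      by (auto simp: append_eq_append_conv2)
    then show ?thesis
    proof cases
      case 1
      then show ?thesis using dyck_path_prefix assms(1) Cons x by fastforce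
    next
      case 2
      then show ?thesis
        using dyck_path_prefix assms(2) dyck_path_height[OF assms(1)] Cons x
        by (cases us) auto
    qed
  qed simp
  then show ?thesis
    unfolding dyck_path_iff using assms by (auto simp: dyck_path_height)
qed

text \<open>The cut is made at the first positive position \<open>k\<close> of height zero. Before
  it the path stays at height at least 1, so the part between the outer \<open>U\<close> and
  \<open>D\<close> is again a Dyck path.\<close>

lemma dyck_path_first_returnE:
  assumes "dyck_path w" "w \<noteq> []"
  obtains v v' where "w = U # v @ D # v'" "dyck_path v" "dyck_path v'"
proof -
  define k where "k = (LEAST k. 0 < k \<and> height (take k w) = 0)"
  have ex: "0 < length w \<and> height (take (length w) w) = 0"
    using assms by (simp add: dyck_path_height)
  have k: "0 < k" "height (take k w) = 0"
    using LeastI[of "\<lambda>k. 0 < k \<and> height (take k w) = 0", OF ex] unfolding k_def by auto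
  have k_le: "k \<le> length w"
    unfolding k_def by (rule Least_le) (rule ex)
  have k_min: "height (take j w) > 0" if "0 < j" "j < k" for j
  proof -
    have "height (take j w) \<noteq> 0"
      using not_less_Least[of j "\<lambda>k. 0 < k \<and> height (take k w) = 0"] that unfolding k_def by auto
    then show ?thesis
      using dyck_path_prefix[of "take j w" "drop j w"] assms(1) by simp
  qed
  define u where "u = take k w"
  have w: "w = u @ drop k w" unfolding u_def by simp
  have u_pos: "0 < height xs" if "u = xs @ ys" "xs \<noteq> []" "ys \<noteq> []" for xs ys
  proof -
    have len: "length xs < k"
      using arg_cong[OF that(1), of length] k_le that(3) by (auto simp: u_def)
    have "xs = take (length xs) u" using that(1) by simp
    then have "xs = take (length xs) w" using len by (simp add: u_def)
    then show ?thesis using k_min[of "length xs"] len that(2) by simp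
  qed
  have "dyck_path u"
    unfolding dyck_path_iff
    using k(2) w assms(1) dyck_path_prefix by (metis append.assoc u_def)
  moreover have "u \<noteq> []" using k(1) assms(2) by (simp add: u_def)
  ultimately have "hd u = U" "last u = D" using dyck_path_hd dyck_path_last by auto
  then obtain v where u: "u = U # v @ [D]"
    using \<open>u \<noteq> []\<close>
    by (metis append_butlast_last_id last_ConsL list.collapse last_ConsR step.distinct(1))
  \<comment> \<open>\<open>U # xs\<close> is a nonempty proper prefix of \<open>u\<close>, hence of
    height at least 1; removing its \<open>U\<close> leaves at least 0.\<close>
  have "0 \<le> height xs" if "v = xs @ ys" for xs ys
    using u_pos[of "U # xs" "ys @ [D]"] u that by simp
  moreover have "height v = 0"
    using k(2) u by (simp add: u_def[symmetric])
  ultimately have "dyck_path v" unfolding dyck_path_iff by blast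
  moreover have "dyck_path (drop k w)"
  proof -
    have hu: "height u = 0" using k(2) by (simp add: u_def)
    have "0 \<le> height xs" if "drop k w = xs @ ys" for xs ys
    proof -
      have "dyck_path ((u @ xs) @ ys)" using assms(1) w that by simp
      then show ?thesis using dyck_path_prefix[of "u @ xs" ys] hu by simp
    qed
    moreover have "height (u @ drop k w) = 0"
      using dyck_path_height[OF assms(1)] w by simp
    ultimately show ?thesis unfolding dyck_path_iff using hu by simp
  qed
  ultimately show ?thesis using that[of v "drop k w"] w u by simp
qed

text \<open>If one of \<open>v\<close>, \<open>v'\<close> were a proper prefix of the other, the
  \<open>D\<close> after the shorter one would take the longer one from height 0 to -1.\<close>

lemma first_return_unique:
  assumes "U # v @ D # w = U # v' @ D # w'" "dyck_path v" "dyck_path v'"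
  shows "v = v' \<and> w = w'"
proof -
  have no: "us = []" if "x @ us = y" "us @ D # w = D # w'" "dyck_path x" "dyck_path y"
    for x y us w w'
  proof (rule ccontr)
    assume "us \<noteq> []"
    with that(2) obtain us' where "us = D # us'" by (cases us) auto
    then have "0 \<le> height (x @ [D])"
      using that(1,4) dyck_path_prefix[of "x @ [D]" us'] by simp
    then show False using dyck_path_height[OF that(3)] by simp
  qed
  from assms(1) consider us where "v = v' @ us" "us @ D # w = D # w'"
    | us where "v @ us = v'" "D # w = us @ D # w'"
    by (auto simp: append_eq_append_conv2)
  then show ?thesis
  proof cases
    case (1 us)
    then have "us = []" using no[of v' us v] assms(2,3) by blast
    then show ?thesis using 1 by simp
  next
    case (2 us)
    then have "us = []" using no[of v us v' w' w] assms(2,3) by metis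
    then show ?thesis using 2 by simp
  qed
qed

section \<open>Dyck paths with long runs\<close>

lemma long_run_paths_eq:
  "long_run_paths r = {w. dyck_path w \<and> long_runs r U w \<and> long_runs r D w}"
  unfolding long_run_paths_def long_runs_def by auto

lemma Nil_in_long_run_paths: "[] \<in> long_run_paths r"
  by (simp add: long_run_paths_eq long_runs_Nil)

lemma dyck_path_replicate: "dyck_path (replicate n U @ replicate n D)"
proof (induction n)
  case (Suc n)
  then show ?case
    using dyck_path_first_returnI[of "replicate n U @ replicate n D" "[]"]
    by (simp add: replicate_append_same)
qed simp

text \<open>Wherever the outer blocks are nonempty, both cuts lie between a \<open>U\<close> and a
  \<open>D\<close>, so the outer blocks are runs of their own.\<close>

lemma long_runs_middle:
  assumes "v \<noteq> []" "hd v = D" "last v = U"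
  shows "long_runs r U (replicate a U @ v @ replicate b D) \<longleftrightarrow>
           (a = 0 \<or> r < a) \<and> long_runs r U v" (is ?U)
    and "long_runs r D (replicate a U @ v @ replicate b D) \<longleftrightarrow>
           (b = 0 \<or> r < b) \<and> long_runs r D v" (is ?D)
proof -
  have 1: "long_runs r c (replicate a U @ v @ replicate b D) \<longleftrightarrow>
      long_runs r c (replicate a U) \<and> long_runs r c (v @ replicate b D)" for c
    using assms by (intro long_runs_append) auto
  have 2: "long_runs r c (v @ replicate b D) \<longleftrightarrow>
      long_runs r c v \<and> long_runs r c (replicate b D)" for c
    using assms by (intro long_runs_append) auto
  show ?U ?D unfolding 1 2 by (auto simp: long_runs_replicate)
qed

lemma long_runs_mountain:
  "long_runs r U (replicate a U @ replicate b D) \<longleftrightarrow> a = 0 \<or> r < a"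
  "long_runs r D (replicate a U @ replicate b D) \<longleftrightarrow> b = 0 \<or> r < b"
proof -
  have "long_runs r c (replicate a U @ replicate b D) \<longleftrightarrow>
      long_runs r c (replicate a U) \<and> long_runs r c (replicate b D)" for c
    by (intro long_runs_append) auto
  then show "long_runs r U (replicate a U @ replicate b D) \<longleftrightarrow> a = 0 \<or> r < a"
    "long_runs r D (replicate a U @ replicate b D) \<longleftrightarrow> b = 0 \<or> r < b"
    by (auto simp: long_runs_replicate)
qed

text \<open>Write \<open>w\<close> as \<open>a\<close> letters \<open>U\<close>, a middle part
  \<open>v\<close>, and \<open>b\<close> letters \<open>D\<close>. Elevation relaxes
  \<open>r < a\<close> and \<open>r < b\<close> to \<open>r <= a\<close> and \<open>r <= b\<close>.
  If \<open>v\<close> is empty, then \<open>a = b\<close> and the only new case is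
  \<open>a = r\<close>. Otherwise long runs inside \<open>v\<close> already force
  \<open>r < a\<close> and \<open>r < b\<close>, so nothing is gained.\<close>

lemma long_runs_elevated_iff:
  assumes "dyck_path w" "w \<noteq> []"
  shows "long_runs r U (U # w @ [D]) \<and> long_runs r D (U # w @ [D]) \<longleftrightarrow>
    w \<in> long_run_paths r \<or> w = replicate r U @ replicate r D"
proof -
  obtain a u where u: "w = replicate a U @ u" "u = [] \<or> hd u \<noteq> U"
    by (rule initial_run)
  obtain b v where v: "u = v @ replicate b D" "v = [] \<or> last v \<noteq> D"
    by (rule final_run)
  have w: "w = replicate a U @ v @ replicate b D" using u v by simp
  have elev: "U # w @ [D] = replicate (Suc a) U @ v @ replicate (Suc b) D"
    using w by (simp add: replicate_append_same)
  have "a \<noteq> 0"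
    using u assms dyck_path_hd[OF assms] by (cases "a = 0") auto
  have "b \<noteq> 0"
    using w v(2) \<open>a \<noteq> 0\<close> dyck_path_last[OF assms]
    by (cases "b = 0") (auto simp: last_append split: if_splits)
  show ?thesis
  proof (cases "v = []")
    case True
    then have "a = b" using dyck_path_height[OF assms(1)] w by simp
    have "w = replicate r U @ replicate r D \<longleftrightarrow> a = r"
    proof
      assume "w = replicate r U @ replicate r D"
      then have "length w = r + r" by simp
      then show "a = r" using w True \<open>a = b\<close> by simp
    qed (use w True \<open>a = b\<close> in simp)
    moreover have "w \<in> long_run_paths r \<longleftrightarrow> r < a"
      using assms(1) w True \<open>a = b\<close> \<open>a \<noteq> 0\<close> by (simp add: long_run_paths_eq long_runs_mountain)
    moreover have "long_runs r U (U # w @ [D]) \<and> long_runs r D (U # w @ [D]) \<longleftrightarrow> r \<le> a"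
      unfolding elev True append_Nil long_runs_mountain using \<open>a = b\<close> by auto
    ultimately show ?thesis by auto
  next
    case False
    have hv: "hd v = D" "last v = U"
      using False u v by (auto simp: step_neq)
    have "w \<in> long_run_paths r \<longleftrightarrow> r < a \<and> r < b \<and> long_runs r U v \<and> long_runs r D v"
      using assms(1) \<open>a \<noteq> 0\<close> \<open>b \<noteq> 0\<close>
      unfolding long_run_paths_eq mem_Collect_eq w long_runs_middle[OF False hv] by auto
    moreover have "long_runs r U (U # w @ [D]) \<and> long_runs r D (U # w @ [D]) \<longleftrightarrow>
        r \<le> a \<and> r \<le> b \<and> long_runs r U v \<and> long_runs r D v"
      unfolding elev long_runs_middle[OF False hv] by auto
    \<comment> \<open>The descending run that opens \<open>v\<close> has length \<open>d > r\<close>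
      and starts at height \<open>a\<close>, so nonnegativity gives \<open>d <= a\<close>.\<close>
    moreover have "r < a" if "long_runs r D v"
    proof -
      obtain d v' where d: "v = replicate d D @ v'" "v' = [] \<or> hd v' \<noteq> D"
        by (rule initial_run)
      have "d \<noteq> 0" using d hv False by (cases "d = 0") auto
      have "long_runs r D v \<longleftrightarrow> long_runs r D (replicate d D) \<and> long_runs r D v'"
        unfolding d(1) using d(2) by (intro long_runs_append) auto
      then have "r < d" using that \<open>d \<noteq> 0\<close> by (simp add: long_runs_replicate)
      moreover have "0 \<le> height (replicate a U @ replicate d D)"
        using dyck_path_prefix[of "replicate a U @ replicate d D" "v' @ replicate b D"] assms(1) w d
        by simp
      ultimately show ?thesis by simp
    qed
    \<comment> \<open>Mirror image: the ascending run that closes \<open>v\<close> has length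
      \<open>e > r\<close>, starts at a nonnegative height and ends at height
      \<open>b\<close>.\<close>
    moreover have "r < b" if "long_runs r U v"
    proof -
      obtain e v' where e: "v = v' @ replicate e U" "v' = [] \<or> last v' \<noteq> U"
        by (rule final_run)
      have "e \<noteq> 0" using e hv False by (cases "e = 0") auto
      have "long_runs r U v \<longleftrightarrow> long_runs r U v' \<and> long_runs r U (replicate e U)"
        unfolding e(1) using e(2) by (intro long_runs_append) auto
      then have "r < e" using that \<open>e \<noteq> 0\<close> by (simp add: long_runs_replicate)
      moreover have "0 \<le> height (replicate a U @ v')"
        using dyck_path_prefix[of "replicate a U @ v'" "replicate e U @ replicate b D"] assms(1) w e
        by simp
      moreover have "height (replicate a U @ v') + int e = int b"
        using dyck_path_height[OF assms(1)] w e by simp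
      ultimately show ?thesis by simp
    qed
    \<comment> \<open>After its initial ascending run, \<open>w\<close> still contains the last
      letter \<open>U\<close> of \<open>v\<close>, whereas the mountain has only \<open>D\<close>
      left.\<close>
    moreover have "w \<noteq> replicate r U @ replicate r D"
    proof
      have drop_U: "dropWhile (\<lambda>x. x = U) (replicate n U @ z) = dropWhile (\<lambda>x. x = U) z" for n z
        by (induction n) simp_all
      assume "w = replicate r U @ replicate r D"
      then have "dropWhile (\<lambda>x. x = U) (replicate a U @ v @ replicate b D) =
          dropWhile (\<lambda>x. x = U) (replicate r U @ replicate r D)"
        using w by simp
      moreover have "dropWhile (\<lambda>x. x = U) (replicate a U @ v @ replicate b D) = v @ replicate b D"
        using False hv(1) unfolding drop_U by (cases v) simp_all
      moreover have "dropWhile (\<lambda>x. x = U) (replicate r U @ replicate r D) = replicate r D"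
        unfolding drop_U by (cases r) simp_all
      ultimately have "set (v @ replicate b D) = set (replicate r D)" by metis
      then have "U \<notin> set v" by (auto simp: set_replicate_conv_if split: if_splits)
      then show False using hv(2) False last_in_set by metis
    qed
    ultimately show ?thesis using less_imp_le by blast
  qed
qed

text \<open>A nonempty \<open>w\<close> starts with \<open>U\<close>, so the cut after the returning
  \<open>D\<close> splits no run. The case \<open>v = []\<close> is excluded because
  \<open>U D\<close> has runs of length 1, which are short as \<open>r > 0\<close>.\<close>

lemma first_return_in_long_run_paths_iff:
  assumes "dyck_path v" "dyck_path w" "r > 0"
  shows "U # v @ D # w \<in> long_run_paths r \<longleftrightarrow>
    v \<noteq> [] \<and> (v \<in> long_run_paths r \<or> v = replicate r U @ replicate r D) \<and> w \<in> long_run_paths r"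
proof -
  have split: "long_runs r c (U # v @ D # w) \<longleftrightarrow> long_runs r c (U # v @ [D]) \<and> long_runs r c w" for c
    using long_runs_append[of "U # v @ [D]" w c r] dyck_path_hd[OF assms(2)] by fastforce
  have "\<not> long_runs r U [U, D]"
    using long_runs_mountain(1)[of r 1 1] assms(3) by simp
  then show ?thesis
    using long_runs_elevated_iff[OF assms(1), of r] dyck_path_first_returnI[OF assms(1,2)] assms(2)
    unfolding long_run_paths_eq mem_Collect_eq split by (cases "v = []") auto
qed

section \<open>Counting\<close>

lemma finite_words_of_length: "finite {w \<in> L. length (w :: step list) = n}"
proof -
  have "(UNIV :: step set) = {U, D}" using step.exhaust by auto
  then have "finite (UNIV :: step set)" by (metis finite.emptyI finite_insert)
  then have "finite {w :: step list. set w \<subseteq> UNIV \<and> length w = n}"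
    by (rule finite_lists_length_eq)
  then show ?thesis by (rule rev_finite_subset) auto
qed

lemma weight_enumerator_Un:
  assumes "A \<inter> B = {}"
  shows "weight_enumerator (A \<union> B) = weight_enumerator A + weight_enumerator B"
proof (rule fps_ext)
  fix n
  have "{w \<in> A \<union> B. length w = 2 * n} = {w \<in> A. length w = 2 * n} \<union> {w \<in> B. length w = 2 * n}"
    by auto
  moreover have "{w \<in> A. length w = 2 * n} \<inter> {w \<in> B. length w = 2 * n} = {}"
    using assms by auto
  ultimately show "fps_nth (weight_enumerator (A \<union> B)) n = fps_nth (weight_enumerator A + weight_enumerator B) n"
    by (simp add: weight_enumerator_def card_Un_disjoint finite_words_of_length)
qed

lemma weight_enumerator_Nil: "weight_enumerator {[]} = 1"
proof (rule fps_ext)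
  fix n
  have "{w \<in> {[]}. length w = 2 * n} = (if n = 0 then {[] :: step list} else {})" by auto
  then show "fps_nth (weight_enumerator {[]}) n = fps_nth 1 n" by (simp add: weight_enumerator_def)
qed

text \<open>By injectivity the words of the image correspond to pairs, so this is a Cauchy product
  shifted by the \<open>k\<close> added semilengths. Since \<open>v\<close> has even length, an even
  total length makes that of \<open>w\<close> even too, and no pair escapes the count by
  semilengths.\<close>

lemma weight_enumerator_image_Times:
  assumes inj: "inj_on f (A \<times> B)"
    and len: "\<And>v w. v \<in> A \<Longrightarrow> w \<in> B \<Longrightarrow> length (f (v, w)) = length v + length w + 2 * k"
    and even: "\<And>v. v \<in> A \<Longrightarrow> even (length v)"
  shows "weight_enumerator (f ` (A \<times> B)) = fps_X ^ k * weight_enumerator A * weight_enumerator B"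
proof (rule fps_ext)
  fix n
  let ?A = "\<lambda>n. {w \<in> A. length w = 2 * n}" and ?B = "\<lambda>n. {w \<in> B. length w = 2 * n}"
  let ?C = "{w \<in> f ` (A \<times> B). length w = 2 * n}"
  show "fps_nth (weight_enumerator (f ` (A \<times> B))) n =
      fps_nth (fps_X ^ k * weight_enumerator A * weight_enumerator B) n"
  proof (cases "n < k")
    case True
    then have "?C = {}" using len by auto
    then have "card ?C = 0" by (simp only: card.empty)
    then show ?thesis
      using True by (simp add: weight_enumerator_def fps_X_power_mult_nth mult.assoc)
  next
    case False
    \<comment> \<open>\<open>m\<close> is the semilength left for \<open>v\<close> and
      \<open>w\<close> together; the pairs are then sorted by the semilength \<open>i\<close> of
      \<open>v\<close>.\<close>
    then obtain m where n: "n = m + k" by (metis add.commute le_add_diff_inverse not_less)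
    have C: "?C = f ` (\<Union>i\<in>{0..m}. ?A i \<times> ?B (m - i))"
    proof (intro equalityI subsetI)
      fix u assume "u \<in> ?C"
      then obtain v w where *: "u = f (v, w)" "v \<in> A" "w \<in> B" "length v + length w = 2 * m"
        using len n by force
      obtain i where i: "length v = 2 * i" using even[OF *(2)] by (elim evenE)
      with * have "i \<in> {0..m}" "(v, w) \<in> ?A i \<times> ?B (m - i)" by auto
      then show "u \<in> f ` (\<Union>i\<in>{0..m}. ?A i \<times> ?B (m - i))" using *(1) by blast
    next
      fix u assume "u \<in> f ` (\<Union>i\<in>{0..m}. ?A i \<times> ?B (m - i))"
      then show "u \<in> ?C" using len n by auto
    qed
    have "card ?C = card (\<Union>i\<in>{0..m}. ?A i \<times> ?B (m - i))"
      unfolding C by (intro card_image inj_on_subset[OF inj]) auto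
    also have "\<dots> = (\<Sum>i=0..m. card (?A i \<times> ?B (m - i)))"
      by (intro card_UN_disjoint) (auto simp: finite_words_of_length)
    finally have "fps_nth (weight_enumerator (f ` (A \<times> B))) n =
        fps_nth (weight_enumerator A * weight_enumerator B) m"
      by (simp add: weight_enumerator_def fps_mult_nth card_cartesian_product)
    also have "\<dots> = fps_nth (fps_X ^ k * (weight_enumerator A * weight_enumerator B)) n"
      by (simp only: fps_X_power_mult_nth) (simp add: n)
    finally show ?thesis by (simp only: mult.assoc)
  qed
qed

lemma weight_enumerator_prepend:
  assumes "length u = 2 * k"
  shows "weight_enumerator ((@) u ` L) = fps_X ^ k * weight_enumerator L"
proof -
  \<comment> \<open>A dummy first factor \<open>{[]}\<close>, of weight 1, turns prepending into an
    instance of the product lemma.\<close>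
  have "(@) u ` L = (\<lambda>(v, w). u @ w) ` ({[] :: step list} \<times> L)" by auto
  moreover have "weight_enumerator ((\<lambda>(v, w). u @ w) ` ({[] :: step list} \<times> L)) = fps_X ^ k * weight_enumerator {[]} * weight_enumerator L"
    using assms by (intro weight_enumerator_image_Times) (auto simp: inj_on_def)
  ultimately show ?thesis by (simp add: weight_enumerator_Nil)
qed

section \<open>The grammatical equation and its weight-enumerator\<close>

lemma conc_singleton: "{u} @@ L = (@) u ` L"
  unfolding conc_def by auto

lemma lang_pow_singleton: "lang_pow {[c]} n = {replicate n c}"
  by (induction n) (auto simp: conc_def)

theorem proposition11:
  fixes r :: nat and \<P> :: "step list set" and P :: "int fps"
  assumes "r > 0"
    and "\<P> = long_run_paths r"
    and "P = weight_enumerator \<P>"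
  shows "\<P> \<union> {[U]} @@ {[D]} @@ \<P> =
           {[]} \<union> lang_pow {[U]} (r + 1) @@ lang_pow {[D]} (r + 1) @@ \<P> \<union> {[U]} @@ \<P> @@ {[D]} @@ \<P>
       \<and> P + fps_X * P = 1 + fps_X ^ (r + 1) * P + fps_X * P ^ 2"
proof -
  \<comment> \<open>\<open>?m\<close> is the one Dyck path outside the language whose elevation has
    only long runs; that elevation is the mountain of height \<open>r + 1\<close>.\<close>
  let ?m = "replicate r U @ replicate r D"
  let ?f = "\<lambda>(v, w). U # v @ D # w"
  have UD: "{[U]} @@ {[D]} @@ \<P> = (@) [U, D] ` \<P>"
    by (auto simp: conc_singleton)
  have mountain: "lang_pow {[U]} (r + 1) @@ lang_pow {[D]} (r + 1) @@ \<P> =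
      (@) (U # ?m @ [D]) ` \<P>"
    unfolding lang_pow_singleton conc_singleton image_image
    by (intro image_cong) (auto simp: replicate_app_Cons_same)
  have UPDP: "{[U]} @@ \<P> @@ {[D]} @@ \<P> = ?f ` (\<P> \<times> \<P>)"
    unfolding conc_def by auto
  have dyck: "dyck_path w" if "w \<in> \<P>" for w
    using that assms(2) by (simp add: long_run_paths_eq)
  have Nil: "[] \<in> \<P>" using assms(2) Nil_in_long_run_paths by simp
  have m: "?m \<notin> \<P>" "?m \<noteq> []"
    using assms(1,2) by (auto simp: long_run_paths_eq long_runs_mountain)
  have fr: "?f (v, w) \<in> \<P> \<longleftrightarrow> v \<noteq> [] \<and> (v \<in> \<P> \<or> v = ?m) \<and> w \<in> \<P>"
    if "dyck_path v" "dyck_path w" for v w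
    using first_return_in_long_run_paths_iff[OF that assms(1)] assms(2) by simp

  \<comment> \<open>In terms of first-return factors \<open>(v, w)\<close> with \<open>w\<close> in
    the language, both sides consist of the empty path and the words with \<open>v\<close> in the
    language or \<open>v = ?m\<close>. On the left, the set with prefix \<open>[U, D]\<close>
    supplies the case \<open>v = []\<close>, which \<open>fr\<close> excludes from the
    language.\<close>
  have grammar: "\<P> \<union> (@) [U, D] ` \<P> = {[]} \<union> (@) (U # ?m @ [D]) ` \<P> \<union> ?f ` (\<P> \<times> \<P>)"
    (is "?L = ?R")
  proof (intro equalityI subsetI)
    fix u assume "u \<in> ?L"
    then consider "u = []" | "u \<in> \<P>" "u \<noteq> []" | w where "w \<in> \<P>" "u = ?f ([], w)" by auto
    then show "u \<in> ?R"
    proof cases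
      case 1
      then show ?thesis by simp
    next
      case 2
      then obtain v w where vw: "u = ?f (v, w)" "dyck_path v" "dyck_path w"
        using dyck_path_first_returnE[OF dyck] by (metis case_prod_conv)
      with fr[OF vw(2,3)] 2 have "v \<in> \<P> \<or> v = ?m" "w \<in> \<P>" by simp_all
      then show ?thesis using vw(1) by auto
    next
      case 3
      then have "u \<in> ?f ` (\<P> \<times> \<P>)" using Nil by (intro image_eqI[of _ _ "([], w)"]) simp_all
      then show ?thesis by simp
    qed
  next
    fix u assume "u \<in> ?R"
    then consider "u = []" | w where "w \<in> \<P>" "u = ?f (?m, w)"
      | v w where "v \<in> \<P>" "w \<in> \<P>" "u = ?f (v, w)" by auto
    then show "u \<in> ?L"
    proof cases
      case 1
      then show ?thesis using Nil by simp
    next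
      case 2
      then show ?thesis using fr[OF dyck_path_replicate dyck] m by auto
    next
      case 3
      then show ?thesis using fr[OF dyck dyck] by (cases "v = []") auto
    qed
  qed

  \<comment> \<open>The weights of both sides add up only over disjoint unions. Here
    \<open>fr\<close> rules out \<open>v = []\<close>.\<close>
  have disj_UD: "\<P> \<inter> (@) [U, D] ` \<P> = {}"
    using fr[OF dyck_path_Nil dyck] by auto
  \<comment> \<open>A common word would have first factor \<open>?m\<close> by uniqueness of the
    decomposition, but \<open>?m\<close> is not in the language.\<close>
  have disj_mountain: "(@) (U # ?m @ [D]) ` \<P> \<inter> ?f ` (\<P> \<times> \<P>) = {}"
  proof -
    have "v = ?m" if "v \<in> \<P>" "U # ?m @ D # w' = U # v @ D # w" for v w w'
      using first_return_unique[OF that(2) dyck_path_replicate dyck[OF that(1)]] by simp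
    with m(1) have "(@) (U # ?m @ [D]) w' \<noteq> ?f (v, w)" if "v \<in> \<P>" for v w w'
      using that by force
    then show ?thesis by blast
  qed
  have inj: "inj_on ?f (\<P> \<times> \<P>)"
  proof (rule inj_onI)
    fix x y assume "x \<in> \<P> \<times> \<P>" "y \<in> \<P> \<times> \<P>" "?f x = ?f y"
    then show "x = y"
      using first_return_unique[of "fst x" "snd x" "fst y" "snd y"] dyck
      by (simp add: split_beta mem_Times_iff prod_eq_iff)
  qed
  have "P + fps_X * P = weight_enumerator (\<P> \<union> (@) [U, D] ` \<P>)"
    unfolding weight_enumerator_Un[OF disj_UD] assms(3)
    by (subst weight_enumerator_prepend[where k = 1]) simp_all
  also have "\<dots> = weight_enumerator ({[]} \<union> ((@) (U # ?m @ [D]) ` \<P> \<union> ?f ` (\<P> \<times> \<P>)))"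
    unfolding grammar Un_assoc ..
  also have "\<dots> = 1 + (weight_enumerator ((@) (U # ?m @ [D]) ` \<P>) + weight_enumerator (?f ` (\<P> \<times> \<P>)))"
    unfolding weight_enumerator_Un[OF disj_mountain, symmetric] weight_enumerator_Nil[symmetric]
    by (rule weight_enumerator_Un) auto
  also have "weight_enumerator ((@) (U # ?m @ [D]) ` \<P>) = fps_X ^ (r + 1) * P"
    unfolding assms(3) by (rule weight_enumerator_prepend) simp
  \<comment> \<open>The exponent 1 accounts for the inserted \<open>U\<close> and \<open>D\<close>,
    which add one semilength.\<close>
  also have "weight_enumerator (?f ` (\<P> \<times> \<P>)) = fps_X ^ 1 * P * P"
    unfolding assms(3)
    by (rule weight_enumerator_image_Times[OF inj]) (auto simp: even_length_dyck_path dyck)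
  finally show ?thesis
    unfolding UD mountain UPDP using grammar by (simp add: power2_eq_square mult.assoc add.assoc)
qed

end
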